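(* Let $s,k\geq 2$ be natural numbers and fix $\boldsymbol{\theta}=(\theta_1,\dotsc,\theta_s)\in(0,1)^s$. Then for all sufficiently small constants $c,c'>0$ (that is, there is $c_0>0$ depending only on $s,k,\boldsymbol{\theta}$ such that for all $c,c'\in(0,c_0]$) the following holds. There exist arbitrarily large $\tau\in\mathbb{R}$ such that for no real $\eta$ with $0<\eta<c\,\tau^{1-2/k}$ do there exist natural numbers $x_1,\dotsc,x_s$ satisfying both $$\left|(x_1-\theta_1)^k+\dotsb+(x_s-\theta_s)^k-\tau\right|<\eta$$ and $$\left|x_i-(\tau/s)^{1/k}\right|<c'\,\tau^{1/(2k)}\qquad\text{for all } 1\leq i\leq s.$$
   Context: Natural numbers are positive integers. "There exist arbitrarily large $\tau$" with a property means: for every $T>0$ there is a real $\tau>T$ with that property. *)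

theory Defs
  imports Complex_Main
begin

end

theory Submission
  imports Defs
begin

text \<open>
  The obstruction is the first-order term of the expansion around the common centre
  \<open>X = (\<tau>/s)\<^bsup>1/k\<^esup>\<close>. Put \<open>d\<^sub>i = x\<^sub>i - \<theta>\<^sub>i - X\<close>, so that
  \[ \sum_i (x_i - \theta_i)^k - \tau = k X^{k-1} \sum_i d_i + O(X^{k-2} \sum_i d_i^2). \]
  The second condition on the \<open>x\<^sub>i\<close> gives \<open>d\<^sub>i\<^sup>2 = O(c'\<^sup>2 X + 1)\<close>, so for small \<open>c'\<close>
  and large \<open>X\<close> the error is a small multiple of \<open>X\<^bsup>k-1\<^esup>\<close>. But \<open>\<Sum>d\<^sub>i\<close> equals an integer
  minus \<open>\<Sum>\<theta>\<^sub>i + s X\<close>, and \<open>X\<close> is free: choosing it so that \<open>\<Sum>\<theta>\<^sub>i + s X\<close> is a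
  half-integer forces \<open>\<bar>\<Sum>d\<^sub>i\<bar> \<ge> 1/2\<close>. The sum of powers therefore misses \<open>\<tau> = s X\<^sup>k\<close> by
  at least a constant times \<open>X\<^bsup>k-1\<^esup>\<close>, which exceeds every admissible \<open>\<eta>\<close>, these being
  \<open>O(X\<^bsup>k-2\<^esup>)\<close>.

  The expansion is lemma \<open>power_linear_remainder\<close>, the resulting lower bound is
  \<open>sum_powers_away_from_centre\<close>, and \<open>half_integer_centre_sum_powers\<close> combines it with the
  choice of \<open>X\<close>. Writing \<open>k = n + 2\<close> in these lemmas keeps truncated subtraction out of the exponents.
\<close>

text \<open>
  The remainder \<open>E\<^sub>n\<close> satisfies \<open>E\<^bsub>n+1\<^esub> = (X + d) E\<^sub>n + (n + 2) X\<^bsup>n+1\<^esup> d\<^sup>2\<close> and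
  \<open>\<bar>X + d\<bar> \<le> 2 X\<close>; the generous constant \<open>4\<^bsup>n+2\<^esup>\<close> absorbs both terms.
\<close>

lemma power_linear_remainder:
  fixes X d :: real
  assumes "\<bar>d\<bar> \<le> X"
  shows "\<bar>(X + d) ^ (n + 2) - X ^ (n + 2) - real (n + 2) * X ^ (n + 1) * d\<bar>
           \<le> 4 ^ (n + 2) * d\<^sup>2 * X ^ n"
proof (induction n)
  case 0
  have "(X + d) ^ (0 + 2) - X ^ (0 + 2) - real (0 + 2) * X ^ (0 + 1) * d = d\<^sup>2"
    by (simp add: power2_eq_square algebra_simps)
  then show ?case by simp
next
  case (Suc n)
  define E where "E = (X + d) ^ (n + 2) - X ^ (n + 2) - real (n + 2) * X ^ (n + 1) * d"
  have X: "X \<ge> 0" using assms by linarith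
  have rec: "(X + d) ^ (Suc n + 2) - X ^ (Suc n + 2) - real (Suc n + 2) * X ^ (Suc n + 1) * d
               = (X + d) * E + real (n + 2) * X ^ (n + 1) * d\<^sup>2"
    unfolding E_def by (simp add: power2_eq_square algebra_simps)
  have "n + 2 < 4 ^ (n + 2)"
    by (rule power_gt_expt) simp
  then have "real (n + 2) < real (4 ^ (n + 2))" by (simp only: of_nat_less_iff)
  moreover have "real (4 ^ (n + 2)) = 4 ^ (n + 2)" by simp
  ultimately have "real (n + 2) \<le> 2 * 4 ^ (n + 2)" by linarith
  then have lin: "real (n + 2) * (X ^ (n + 1) * d\<^sup>2) \<le> 2 * 4 ^ (n + 2) * (X ^ (n + 1) * d\<^sup>2)"
    using X by (intro mult_right_mono) auto
  have "\<bar>(X + d) * E\<bar> \<le> (2 * X) * (4 ^ (n + 2) * d\<^sup>2 * X ^ n)"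
    unfolding abs_mult using Suc.IH assms by (intro mult_mono) (auto simp: E_def)
  moreover have "\<bar>real (n + 2) * X ^ (n + 1) * d\<^sup>2\<bar> = real (n + 2) * (X ^ (n + 1) * d\<^sup>2)"
    using X by (simp add: abs_mult)
  moreover have "(2 * X) * (4 ^ (n + 2) * d\<^sup>2 * X ^ n) + 2 * 4 ^ (n + 2) * (X ^ (n + 1) * d\<^sup>2)
                   = 4 ^ (Suc n + 2) * d\<^sup>2 * X ^ Suc n"
    by (simp add: algebra_simps)
  ultimately show ?case
    unfolding rec using lin by linarith
qed

lemma sum_powers_away_from_centre:
  fixes X B :: real and d :: "'a \<Rightarrow> real"
  assumes "X \<ge> 0" and small: "\<And>i. i \<in> I \<Longrightarrow> \<bar>d i\<bar> \<le> X" and sq: "\<And>i. i \<in> I \<Longrightarrow> (d i)\<^sup>2 \<le> B"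
    and far: "\<bar>\<Sum>i\<in>I. d i\<bar> \<ge> 1/2"
  shows "\<bar>(\<Sum>i\<in>I. (X + d i) ^ (n + 2)) - real (card I) * X ^ (n + 2)\<bar>
           \<ge> X ^ (n + 1) - real (card I) * (4 ^ (n + 2) * B * X ^ n)"
proof -
  define R where "R i = (X + d i) ^ (n + 2) - X ^ (n + 2) - real (n + 2) * X ^ (n + 1) * d i" for i
  have "\<bar>R i\<bar> \<le> 4 ^ (n + 2) * B * X ^ n" if "i \<in> I" for i
  proof -
    have "\<bar>R i\<bar> \<le> 4 ^ (n + 2) * (d i)\<^sup>2 * X ^ n"
      unfolding R_def by (rule power_linear_remainder[OF small[OF that]])
    also have "\<dots> \<le> 4 ^ (n + 2) * B * X ^ n"
      using sq[OF that] \<open>X \<ge> 0\<close> by (intro mult_right_mono mult_left_mono) auto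
    finally show ?thesis .
  qed
  then have "(\<Sum>i\<in>I. \<bar>R i\<bar>) \<le> real (card I) * (4 ^ (n + 2) * B * X ^ n)"
    by (intro sum_bounded_above)
  then have err: "\<bar>\<Sum>i\<in>I. R i\<bar> \<le> real (card I) * (4 ^ (n + 2) * B * X ^ n)"
    using sum_abs order_trans by blast
  have "X ^ (n + 1) * 1 \<le> X ^ (n + 1) * (real (n + 2) * \<bar>\<Sum>i\<in>I. d i\<bar>)"
  proof (rule mult_left_mono)
    have "2 * (1/2) \<le> real (n + 2) * \<bar>\<Sum>i\<in>I. d i\<bar>"
      using far by (intro mult_mono) auto
    then show "1 \<le> real (n + 2) * \<bar>\<Sum>i\<in>I. d i\<bar>" by simp
  qed (use \<open>X \<ge> 0\<close> in simp)
  then have main: "X ^ (n + 1) \<le> \<bar>real (n + 2) * X ^ (n + 1) * (\<Sum>i\<in>I. d i)\<bar>"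
    using \<open>X \<ge> 0\<close> by (simp add: abs_mult mult_ac)
  have "(\<Sum>i\<in>I. (X + d i) ^ (n + 2)) - real (card I) * X ^ (n + 2)
          = real (n + 2) * X ^ (n + 1) * (\<Sum>i\<in>I. d i) + (\<Sum>i\<in>I. R i)"
    unfolding R_def by (simp add: sum_subtractf sum_distrib_left)
  with main err show ?thesis by linarith
qed

text \<open>
  Since \<open>\<Sum>\<theta>\<^sub>i + s X\<close> is a half-integer, the deviations \<open>x\<^sub>i - \<theta>\<^sub>i - X\<close> cannot cancel. Of the
  main term \<open>X\<^bsup>n+1\<^esup>\<close>, the square of the radius \<open>a\<close> may consume a share of one eighth and the shifts
  \<open>\<theta>\<^sub>i\<close> another eighth; this is where the two bounds below come from.
\<close>

lemma half_integer_centre_sum_powers: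
  fixes X a :: real and \<theta> :: "'a \<Rightarrow> real" and x :: "'a \<Rightarrow> int"
  assumes half: "(\<Sum>i\<in>I. \<theta> i) + real (card I) * X = of_int m + 1/2"
    and theta: "\<And>i. i \<in> I \<Longrightarrow> 0 \<le> \<theta> i \<and> \<theta> i \<le> 1"
    and near: "\<And>i. i \<in> I \<Longrightarrow> \<bar>of_int (x i) - X\<bar> \<le> a"
    and radius: "16 * (real (card I) * 4 ^ (n + 2)) * a\<^sup>2 \<le> X"
    and large: "16 * (real (card I) * 4 ^ (n + 2)) \<le> X"
    and I: "finite I" "I \<noteq> {}"
  shows "\<bar>(\<Sum>i\<in>I. (of_int (x i) - \<theta> i) ^ (n + 2)) - real (card I) * X ^ (n + 2)\<bar>
           \<ge> X ^ (n + 1) / 2"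
proof -
  define K where "K = real (card I) * 4 ^ (n + 2)"
  have "1 \<le> real (card I)" using I by (simp add: Suc_leI card_gt_0_iff)
  then have "1 * 1 \<le> K"
    unfolding K_def by (intro mult_mono one_le_power) auto
  then have K: "1 \<le> K" by simp
  then have X: "X \<ge> 16" and "a\<^sup>2 \<le> K * a\<^sup>2"
    using large mult_right_mono[of 1 K "a\<^sup>2"] unfolding K_def[symmetric] by auto
  then have a2: "16 * a\<^sup>2 \<le> X" using radius unfolding K_def[symmetric] by linarith
  define d where "d i = of_int (x i) - \<theta> i - X" for i
  define B where "B = 2 * a\<^sup>2 + 2"
  have sq: "(d i)\<^sup>2 \<le> B" if "i \<in> I" for i
  proof -
    have "\<bar>d i\<bar> \<le> a + 1" "0 \<le> a"
      using near[OF that] theta[OF that] unfolding d_def by linarith+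
    then have "(d i)\<^sup>2 \<le> (a + 1)\<^sup>2" by (simp add: abs_le_square_iff[symmetric])
    also have "\<dots> = B - (a - 1)\<^sup>2" unfolding B_def by (simp add: power2_eq_square algebra_simps)
    finally show ?thesis by (smt (verit) zero_le_power2)
  qed
  have "B \<le> X" using a2 X unfolding B_def by linarith
  also have "X \<le> X\<^sup>2" using X by (simp add: power2_eq_square)
  finally have small: "\<bar>d i\<bar> \<le> X" if "i \<in> I" for i
    using sq[OF that] X by (metis abs_le_square_iff abs_of_nonneg order_trans zero_le_numeral)
  have "(\<Sum>i\<in>I. d i) = of_int ((\<Sum>i\<in>I. x i) - m) - 1/2"
    using half unfolding d_def by (simp add: sum_subtractf)
  moreover have "\<bar>real_of_int j - 1/2\<bar> \<ge> 1/2" for j :: int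
    by (cases "j \<le> 0") auto
  ultimately have far: "\<bar>\<Sum>i\<in>I. d i\<bar> \<ge> 1/2" by metis
  have "K * B = 2 * (K * a\<^sup>2) + 2 * K" unfolding B_def by (simp add: algebra_simps)
  then have "K * B \<le> X / 2"
    using radius large X unfolding K_def[symmetric] mult.assoc by linarith
  then have "K * B * X ^ n \<le> X / 2 * X ^ n" using X by (intro mult_right_mono) auto
  then have err: "real (card I) * (4 ^ (n + 2) * B * X ^ n) \<le> X ^ (n + 1) / 2"
    unfolding K_def by (simp add: mult.assoc)
  have "X ^ (n + 1) - real (card I) * (4 ^ (n + 2) * B * X ^ n)
          \<le> \<bar>(\<Sum>i\<in>I. (X + d i) ^ (n + 2)) - real (card I) * X ^ (n + 2)\<bar>"
    using X by (intro sum_powers_away_from_centre small sq far) auto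
  moreover have "X + d i = of_int (x i) - \<theta> i" for i unfolding d_def by simp
  ultimately show ?thesis using err by simp
qed

theorem theorem1:
  fixes s k :: nat and \<theta> :: "nat \<Rightarrow> real"
  assumes "s \<ge> 2" and "k \<ge> 2"
    and "\<forall>i\<in>{1..s}. 0 < \<theta> i \<and> \<theta> i < 1"
  shows "\<exists>c0::real. c0 > 0 \<and>
    (\<forall>c c' :: real. 0 < c \<and> c \<le> c0 \<and> 0 < c' \<and> c' \<le> c0 \<longrightarrow>
      (\<forall>T::real. T > 0 \<longrightarrow>
        (\<exists>\<tau>::real. \<tau> > T \<and>
          \<not> (\<exists>\<eta>::real. 0 < \<eta> \<and> \<eta> < c * \<tau> powr (1 - 2 / real k) \<and>
              (\<exists>x :: nat \<Rightarrow> nat.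
                (\<forall>i\<in>{1..s}. x i \<ge> 1) \<and>
                \<bar>(\<Sum>i=1..s. (real (x i) - \<theta> i) ^ k) - \<tau>\<bar> < \<eta> \<and>
                (\<forall>i\<in>{1..s}. \<bar>real (x i) - (\<tau> / real s) powr (1 / real k)\<bar>
                    < c' * \<tau> powr (1 / (2 * real k))))))))"
proof -
  obtain n where k: "k = n + 2" using \<open>k \<ge> 2\<close> by (metis add.commute le_Suc_ex)
  have s: "real s \<ge> 2" using \<open>s \<ge> 2\<close> by simp
  \<comment> \<open>The squared radius is at most \<open>c0\<^sup>2 s X\<close>, so this \<open>c0\<close> is what the bound on the radius requires.\<close>
  define c0 where "c0 = 1 / (4 * real s * 2 ^ k)"
  have c0_pos: "c0 > 0" using s by (simp add: c0_def)
  have "(2::real) ^ k * 2 ^ k = 4 ^ k" by (simp flip: power_mult_distrib)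
  then have c0_sq: "16 * (real s * 4 ^ k) * (c0\<^sup>2 * real s) = 1"
    using s by (simp add: c0_def power2_eq_square field_simps)
  have "c0 * real s = 1 / (4 * 2 ^ k)" using s by (simp add: c0_def)
  also have "\<dots> \<le> 1 / 4"
    by (simp add: field_simps)
  finally have c0_s: "c0 * real s \<le> 1 / 4" .
  show ?thesis
  proof (rule exI[of _ c0], intro conjI allI impI)
    fix c c' T :: real
    assume "0 < c \<and> c \<le> c0 \<and> 0 < c' \<and> c' \<le> c0" and "T > 0"
    then have c: "0 < c" "c \<le> c0" and c': "0 < c'" "c' \<le> c0" by auto
    define M where "M = T + 16 * (real s * 4 ^ k)"
    define m where "m = \<lceil>real s * M + (\<Sum>i=1..s. \<theta> i)\<rceil>"
    define X where "X = (of_int m + 1/2 - (\<Sum>i=1..s. \<theta> i)) / real s"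
    define \<tau> where "\<tau> = real s * X ^ k"
    have "real s * M \<le> of_int m + 1/2 - (\<Sum>i=1..s. \<theta> i)" unfolding m_def by linarith
    then have XM: "M \<le> X" unfolding X_def using s by (simp add: field_simps)
    have "real s * 4 ^ k \<ge> 1 * 1" using s by (intro mult_mono) auto
    then have X: "X > T" "X \<ge> 1" "16 * (real s * 4 ^ k) \<le> X"
      using XM \<open>T > 0\<close> s unfolding M_def by auto
    have half: "(\<Sum>i\<in>{1..s}. \<theta> i) + real (card {1..s}) * X = of_int m + 1/2"
      unfolding X_def using s by simp
    have root: "(X ^ k) powr (p / real k) = X powr p" for p
    proof -
      have "X ^ k = X powr real k" using X(2) by (simp add: powr_realpow)
      then show ?thesis using k by (simp add: powr_powr)
    qed
    have "1 * X \<le> real s * X ^ k"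
      using X(2) s k by (intro mult_mono self_le_power) auto
    then have "\<tau> > T" unfolding \<tau>_def using X by linarith
    have centre: "(\<tau> / real s) powr (1 / real k) = X"
      using root[of 1] X(2) s by (simp add: \<tau>_def)
    have s_powr: "real s powr p \<le> real s" if "p \<le> 1" for p
      using powr_mono[OF that, of "real s"] s by simp
    \<comment> \<open>The admissible window for \<open>\<eta>\<close> is one power of \<open>X\<close> below the gap.\<close>
    have "\<tau> powr (1 - 2 / real k) \<le> real s * X ^ n"
    proof -
      have "1 - 2 / real k = real n / real k" using k by (simp add: field_simps)
      then have "\<tau> powr (1 - 2 / real k) = real s powr (1 - 2 / real k) * X ^ n"
        using root[of "real n"] X(2) by (simp add: \<tau>_def powr_mult powr_realpow)
      then show ?thesis using s_powr[of "1 - 2 / real k"] X(2) by (simp add: mult_right_mono)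
    qed
    then have "c * \<tau> powr (1 - 2 / real k) \<le> c0 * (real s * X ^ n)"
      using c c0_pos by (intro mult_mono) auto
    also have "\<dots> = (c0 * real s) * X ^ n" by simp
    also have "\<dots> \<le> 1 / 2 * X ^ (n + 1)"
      using c0_s X(2) by (intro mult_mono power_increasing) auto
    finally have window: "c * \<tau> powr (1 - 2 / real k) \<le> X ^ (n + 1) / 2" by simp
    define a where "a = c' * \<tau> powr (1 / (2 * real k))"
    have radius: "16 * (real s * 4 ^ k) * a\<^sup>2 \<le> X"
    proof -
      have "(\<tau> powr (1 / (2 * real k)))\<^sup>2 = \<tau> powr (1 / real k)"
        by (simp add: power2_eq_square flip: powr_add)
      also have "\<dots> = real s powr (1 / real k) * X"
        using root[of 1] X(2) by (simp add: \<tau>_def powr_mult)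
      also have "\<dots> \<le> real s * X"
        using s_powr[of "1 / real k"] k X(2) by (simp add: mult_right_mono)
      finally have "a\<^sup>2 \<le> c0\<^sup>2 * (real s * X)"
        unfolding a_def power_mult_distrib using c' by (intro mult_mono power_mono) auto
      then have "16 * (real s * 4 ^ k) * a\<^sup>2 \<le> 16 * (real s * 4 ^ k) * (c0\<^sup>2 * (real s * X))"
        by (intro mult_left_mono) auto
      also have "\<dots> = 16 * (real s * 4 ^ k) * (c0\<^sup>2 * real s) * X" by (simp add: mult_ac)
      finally show ?thesis unfolding c0_sq by simp
    qed
    have gap: "X ^ (n + 1) / 2 \<le> \<bar>(\<Sum>i=1..s. (real (x i) - \<theta> i) ^ k) - \<tau>\<bar>"
      if "\<forall>i\<in>{1..s}. \<bar>real (x i) - X\<bar> < a" for x :: "nat \<Rightarrow> nat"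
      using half_integer_centre_sum_powers[OF half, of "\<lambda>i. int (x i)" a n]
        that assms(3) radius X(3) s
      by (force simp: k \<tau>_def less_imp_le)
    have "\<not> (\<exists>\<eta>. 0 < \<eta> \<and> \<eta> < c * \<tau> powr (1 - 2 / real k) \<and>
              (\<exists>x :: nat \<Rightarrow> nat.
                (\<forall>i\<in>{1..s}. x i \<ge> 1) \<and>
                \<bar>(\<Sum>i=1..s. (real (x i) - \<theta> i) ^ k) - \<tau>\<bar> < \<eta> \<and>
                (\<forall>i\<in>{1..s}. \<bar>real (x i) - (\<tau> / real s) powr (1 / real k)\<bar>
                    < c' * \<tau> powr (1 / (2 * real k)))))" (is "\<not> ?solvable \<tau>")
      unfolding centre a_def[symmetric] using gap window by fastforce
    with \<open>\<tau> > T\<close> show "\<exists>\<tau>>T. \<not> ?solvable \<tau>" by blast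
  qed (rule c0_pos)
qed

end
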